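(* Every cubic bipartite graph is $4$-flow-connected.
   Context: Graphs are finite. A cycle is a connected 2-regular graph. Fix an arbitrary orientation $D$ of $G$; for a vertex $v$ let $E_D^+(v)$ and $E_D^-(v)$ be the sets of edges directed out of and into $v$. For a positive integer $k$, a $k$-flow (always nowhere-zero) is a function $f:E(G)\to\mathbb{Z}$ with $0<|f(e)|<k$ for all edges $e$ and $\sum_{e\in E_D^+(v)}f(e)=\sum_{e\in E_D^-(v)}f(e)$ for every vertex $v$. (Flows given with different orientations are identified by negating the value of every edge whose orientation is reversed, so the choice of $D$ does not matter.) Two $k$-flows $f',f''$ are $k$-flow-adjacent if there is a cycle $C$ in $G$ such that $f'(e)=f''(e)$ for all $e\notin E(C)$, and $k$-flow-equivalent if they are joined by a finite sequence of $k$-flows in which consecutive ones are $k$-flow-adjacent. $G$ is $k$-flow-connected if all its $k$-flows are pairwise $k$-flow-equivalent (vacuously true if there are none). *)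

theory Defs
  imports "HOL-Library.FuncSet" "Graph_Theory.Digraph"
begin

text \<open>
  Undirected graphs. Edges are objects of their own, so parallel edges and loops are allowed;
  \<open>ends G e\<close> is the set of end vertices of \<open>e\<close>, a singleton exactly when \<open>e\<close> is a loop.
\<close>

record ('v, 'e) mgraph =
  vertices :: "'v set"
  edges :: "'e set"
  ends :: "'e \<Rightarrow> 'v set"

definition finite_graph :: "('v, 'e) mgraph \<Rightarrow> bool" where
  "finite_graph G \<longleftrightarrow> finite (vertices G) \<and> finite (edges G) \<and>
     (\<forall>e\<in>edges G. ends G e \<subseteq> vertices G \<and> card (ends G e) \<in> {1, 2})"

text \<open>A loop contributes two to the degree of its end vertex.\<close>

definition degree :: "('v, 'e) mgraph \<Rightarrow> 'v \<Rightarrow> nat" where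
  "degree G v = card {e \<in> edges G. v \<in> ends G e} + card {e \<in> edges G. ends G e = {v}}"

definition regular :: "nat \<Rightarrow> ('v, 'e) mgraph \<Rightarrow> bool" where
  "regular d G \<longleftrightarrow> (\<forall>v\<in>vertices G. degree G v = d)"

definition cubic :: "('v, 'e) mgraph \<Rightarrow> bool" where
  "cubic G \<longleftrightarrow> regular 3 G"

definition bipartite :: "('v, 'e) mgraph \<Rightarrow> bool" where
  "bipartite G \<longleftrightarrow> (\<exists>A B. A \<union> B = vertices G \<and> A \<inter> B = {} \<and>
     (\<forall>e\<in>edges G. \<exists>a\<in>A. \<exists>b\<in>B. ends G e = {a, b}))"

definition connected_graph :: "('v, 'e) mgraph \<Rightarrow> bool" where
  "connected_graph G \<longleftrightarrow> vertices G \<noteq> {} \<and>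
     (\<forall>u\<in>vertices G. \<forall>v\<in>vertices G. (\<lambda>x y. \<exists>e\<in>edges G. ends G e = {x, y})\<^sup>*\<^sup>* u v)"

definition is_cycle :: "('v, 'e) mgraph \<Rightarrow> bool" where
  "is_cycle C \<longleftrightarrow> finite_graph C \<and> connected_graph C \<and> regular 2 C"

definition is_subgraph :: "('v, 'e) mgraph \<Rightarrow> ('v, 'e) mgraph \<Rightarrow> bool" where
  "is_subgraph H G \<longleftrightarrow> vertices H \<subseteq> vertices G \<and> edges H \<subseteq> edges G \<and>
     (\<forall>e\<in>edges H. ends H e = ends G e)"

definition orientation :: "('v, 'e) pre_digraph \<Rightarrow> ('v, 'e) mgraph \<Rightarrow> bool" where
  "orientation D G \<longleftrightarrow> verts D = vertices G \<and> arcs D = edges G \<and>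
     (\<forall>e\<in>edges G. {tail D e, head D e} = ends G e)"

text \<open>
  A flow is a function on the edge set only, hence the condition \<open>f \<in> extensional (arcs D)\<close>:
  flows that agree on all edges are equal.
\<close>

definition k_flow :: "nat \<Rightarrow> ('v, 'e) pre_digraph \<Rightarrow> ('e \<Rightarrow> int) \<Rightarrow> bool" where
  "k_flow k D f \<longleftrightarrow> f \<in> extensional (arcs D) \<and>
     (\<forall>e\<in>arcs D. 0 < \<bar>f e\<bar> \<and> \<bar>f e\<bar> < int k) \<and>
     (\<forall>v\<in>verts D. (\<Sum>e\<in>out_arcs D v. f e) = (\<Sum>e\<in>in_arcs D v. f e))"

definition k_flow_adjacent ::
  "nat \<Rightarrow> ('v, 'e) mgraph \<Rightarrow> ('v, 'e) pre_digraph \<Rightarrow> ('e \<Rightarrow> int) \<Rightarrow> ('e \<Rightarrow> int) \<Rightarrow> bool" where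
  "k_flow_adjacent k G D f' f'' \<longleftrightarrow> k_flow k D f' \<and> k_flow k D f'' \<and>
     (\<exists>C. is_cycle C \<and> is_subgraph C G \<and> (\<forall>e\<in>edges G - edges C. f' e = f'' e))"

definition k_flow_equivalent ::
  "nat \<Rightarrow> ('v, 'e) mgraph \<Rightarrow> ('v, 'e) pre_digraph \<Rightarrow> ('e \<Rightarrow> int) \<Rightarrow> ('e \<Rightarrow> int) \<Rightarrow> bool" where
  "k_flow_equivalent k G D f' f'' \<longleftrightarrow> k_flow k D f' \<and> k_flow k D f'' \<and>
     (k_flow_adjacent k G D)\<^sup>*\<^sup>* f' f''"

text \<open>
  The choice of orientation is immaterial, as reversing an edge amounts to negating its flow value;
  the definition requires the property for every orientation.
\<close>

definition k_flow_connected :: "nat \<Rightarrow> ('v, 'e) mgraph \<Rightarrow> bool" where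
  "k_flow_connected k G \<longleftrightarrow> (\<forall>D f' f''. orientation D G \<longrightarrow> k_flow k D f' \<longrightarrow> k_flow k D f'' \<longrightarrow>
     k_flow_equivalent k G D f' f'')"

end

theory Submission imports Defs begin

text \<open>
  Let \<open>A\<close>, \<open>B\<close> be the two sides of a cubic bipartite graph, and let every flow value be read in
  the direction from \<open>A\<close> to \<open>B\<close>. Then \<open>\<phi> :: 'e \<Rightarrow> int\<close> is a 4-flow if and only if its values lie in
  \<open>{-3..3} - {0}\<close> and the three values at each vertex sum to zero. By parity, each vertex meets
  exactly one edge of even value, which is \<open>2\<close> or \<open>-2\<close>, so the even edges form a perfect matching
  \<open>M\<close>. Modulo 4, the two odd values at a vertex are equal.

  Flows are joined by a single principle, \<open>equivalent_if_diff_const\<close>: two flows whose difference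
  takes only the values \<open>0\<close>, \<open>c\<close>, \<open>-c\<close> for one constant \<open>c\<close> are equivalent. Three terms \<open>c\<close> or \<open>-c\<close>
  cannot sum to zero, and neither can a single one, so the edges on which the flows differ induce a
  2-regular graph; its components are cycles, and one flow can be turned into the other on one
  component at a time. The intermediate functions are flows, as at each vertex they agree with one
  of the two given flows.

  The canonical flow of \<open>M\<close> has value \<open>-2\<close> on \<open>M\<close> and \<open>1\<close> elsewhere. The canonical flows of two
  perfect matchings differ by \<open>0\<close> or \<open>\<plusminus>3\<close>, hence are equivalent. It remains to join an arbitrary
  4-flow \<open>\<phi>\<close> to the canonical flow of its own \<open>M\<close>. Let \<open>F\<close> be the set of edges with
  \<open>\<phi> e mod 4 = 3\<close>. It is 2-regular on the vertices that it meets, so its components are even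
  cycles, and signs \<open>s e = \<plusminus>1\<close> can be chosen on \<open>F\<close> alternating along them (\<open>balanced_signing\<close>).
  Subtracting \<open>2 * s e\<close> from the canonical flow on \<open>F\<close> gives a flow \<open>\<gamma>\<close> that takes the values
  \<open>-1\<close> and \<open>3\<close> on \<open>F\<close>. Thus \<open>\<gamma>\<close> agrees with \<open>\<phi>\<close> modulo 4 and differs from it by \<open>0\<close> or \<open>\<plusminus>4\<close>,
  while it differs from the canonical flow by \<open>0\<close> or \<open>\<plusminus>2\<close>: two more applications of the principle.
\<close>

section \<open>Signings alternating under two pairings\<close>

text \<open>
  The union of two perfect matchings \<open>{e, p e}\<close> and \<open>{e, q e}\<close> on the points of \<open>F\<close> has no odd cycle,
  hence is 2-colourable. For the induction a pair \<open>{x, p x}\<close> is removed and the two points left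
  without \<open>q\<close>-partner are paired with each other. Such a pair receives opposite colours, so each of
  the removed points can be coloured against its own \<open>q\<close>-partner.
\<close>

lemma involutions_signing:
  assumes "finite F"
    and "\<And>e. e \<in> F \<Longrightarrow> p e \<in> F \<and> p e \<noteq> e \<and> p (p e) = e"
    and "\<And>e. e \<in> F \<Longrightarrow> q e \<in> F \<and> q e \<noteq> e \<and> q (q e) = e"
  shows "\<exists>s :: 'a \<Rightarrow> bool. \<forall>e\<in>F. s (p e) = (\<not> s e) \<and> s (q e) = (\<not> s e)"
  using assms
proof (induction "card F" arbitrary: F q rule: less_induct)
  case less
  note p = less.prems(2) and q = less.prems(3)
  show ?case
  proof (cases "F = {}")
    case False
    then obtain x where x: "x \<in> F" by blast
    define y where "y = p x"
    have y: "y \<in> F" "y \<noteq> x" "p y = x" "p x = y" using p[OF x] by (auto simp: y_def)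
    define F' where "F' = F - {x, y}"
    have F': "card F' < card F" "finite F'"
      using x less.prems(1) by (auto simp: F'_def intro!: psubset_card_mono)
    have p': "p e \<in> F' \<and> p e \<noteq> e \<and> p (p e) = e" if "e \<in> F'" for e
      using p[of e] that y by (auto simp: F'_def)
    \<comment> \<open>If \<open>q\<close> pairs \<open>x\<close> with \<open>y\<close>, it restricts to \<open>F'\<close>; otherwise their former partners are paired.\<close>
    define q' where "q' = (if q x = y then q else q(q x := q y, q y := q x))"
    have q': "q' e \<in> F' \<and> q' e \<noteq> e \<and> q' (q' e) = e" if "e \<in> F'" for e
    proof -
      have e: "e \<in> F" "e \<noteq> x" "e \<noteq> y" using that by (auto simp: F'_def)
      have inj: "q a = q b \<longleftrightarrow> a = b" if "a \<in> F" "b \<in> F" for a b using q that by metis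
      have "q x = y \<longleftrightarrow> q y = x" using q x y(1) by metis
      then show ?thesis
        using q[OF e(1)] q[OF x] q[OF y(1)] inj[OF e(1) x] inj[OF e(1) y(1)] inj[OF x y(1)] e y(2)
        unfolding F'_def q'_def by (cases "e = q x"; cases "e = q y"; force)
    qed
    obtain s where s: "\<forall>e\<in>F'. s (p e) = (\<not> s e) \<and> s (q' e) = (\<not> s e)"
      using less.hyps[OF F' p' q'] by blast
    show ?thesis
    proof (cases "q x = y")
      case True
      have "\<forall>e\<in>F. (s(x := True, y := False)) (p e) = (\<not> (s(x := True, y := False)) e)
         \<and> (s(x := True, y := False)) (q e) = (\<not> (s(x := True, y := False)) e)"
      proof
        fix e assume "e \<in> F"
        then show "(s(x := True, y := False)) (p e) = (\<not> (s(x := True, y := False)) e)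
         \<and> (s(x := True, y := False)) (q e) = (\<not> (s(x := True, y := False)) e)"
          using True s[rule_format, of e] p[of e] q[of e] q[OF x] y
          by (auto simp: F'_def q'_def)
      qed
      then show ?thesis by blast
    next
      case False
      define t where "t = s(x := \<not> s (q x), y := \<not> s (q y))"
      have mem: "q x \<in> F'" "q y \<in> F'" "q x \<noteq> q y" "q x \<noteq> x" "q x \<noteq> y" "q y \<noteq> x" "q y \<noteq> y"
        using False q[OF x] q[OF y(1)] x y by (auto simp: F'_def)
      have sq: "s (q y) = (\<not> s (q x))"
        using s[rule_format, OF mem(1)] mem(3) False by (auto simp: q'_def)
      have "\<forall>e\<in>F. t (p e) = (\<not> t e) \<and> t (q e) = (\<not> t e)"
      proof
        fix e assume e: "e \<in> F"
        consider "e = x" | "e = y" | "e = q x" | "e = q y" | "e \<in> F'" "e \<noteq> q x" "e \<noteq> q y"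
          using e by (auto simp: F'_def)
        then show "t (p e) = (\<not> t e) \<and> t (q e) = (\<not> t e)"
        proof cases
          case 1
          then show ?thesis using mem y sq by (simp add: t_def)
        next
          case 2
          then show ?thesis using mem y sq by (simp add: t_def)
        next
          case 3
          then show ?thesis using mem y sq q[OF x] s[rule_format, OF mem(1)] p'[OF mem(1)]
            by (auto simp: t_def F'_def)
        next
          case 4
          then show ?thesis using mem y sq q[OF y(1)] s[rule_format, OF mem(2)] p'[OF mem(2)]
            by (auto simp: t_def F'_def)
        next
          case 5
          have "q e \<noteq> x" "q e \<noteq> y" using 5 q[of e] e by auto
          then show ?thesis using 5 s[rule_format, OF 5(1)] p'[OF 5(1)] False
            by (auto simp: t_def F'_def q'_def)
        qed
      qed
      then show ?thesis by blast
    qed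
  qed simp
qed

lemma fiber_partner:
  assumes "finite F" "\<And>e. e \<in> F \<Longrightarrow> card {e' \<in> F. t e' = t e} = 2"
  shows "\<exists>p. \<forall>e\<in>F. p e \<in> F \<and> p e \<noteq> e \<and> p (p e) = e \<and> {e' \<in> F. t e' = t e} = {e, p e}"
proof -
  have "\<exists>e'. {e'' \<in> F. t e'' = t e} = {e, e'} \<and> e' \<noteq> e" if "e \<in> F" for e
  proof -
    obtain a b where ab: "{e'' \<in> F. t e'' = t e} = {a, b}" "a \<noteq> b"
      using assms(2)[OF \<open>e \<in> F\<close>] unfolding card_2_iff by blast
    then have "e = a \<or> e = b" using that by blast
    then show ?thesis using ab by (metis insert_commute)
  qed
  then obtain p where p: "\<And>e. e \<in> F \<Longrightarrow> {e' \<in> F. t e' = t e} = {e, p e} \<and> p e \<noteq> e" by metis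
  have p1: "p e \<in> F \<and> t (p e) = t e" if "e \<in> F" for e using p[OF that] by blast
  have "p (p e) = e" if "e \<in> F" for e
  proof -
    have "p e \<in> F" "t (p e) = t e" using p1[OF that] by simp_all
    then have "{p e, p (p e)} = {e, p e}" using p[OF that] p[of "p e"] by simp
    then show ?thesis using p[OF that] by (simp add: doubleton_eq_iff)
  qed
  then show ?thesis using p p1 by blast
qed

section \<open>Flows as zero-sum edge weights\<close>

locale oriented_cubic_bipartite =
  fixes G :: "('v, 'e) mgraph" and A B :: "'v set" and D :: "('v, 'e) pre_digraph"
  assumes fin: "finite_graph G" and cub: "cubic G"
    and AB: "A \<union> B = vertices G" "A \<inter> B = {}"
    and ends_AB: "\<And>e. e \<in> edges G \<Longrightarrow> \<exists>a\<in>A. \<exists>b\<in>B. ends G e = {a, b}"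
    and orient: "orientation D G"
begin

definition star :: "'v \<Rightarrow> 'e set" where
  "star v = {e \<in> edges G. v \<in> ends G e}"

text \<open>Converts between values in the orientation \<open>D\<close> and values read from \<open>A\<close> to \<open>B\<close>.\<close>

definition dir :: "'e \<Rightarrow> int" where
  "dir e = (if tail D e \<in> A then 1 else -1)"

lemma dir_dir [simp]: "dir e * dir e = 1" "dir e * (dir e * x) = x" "\<bar>dir e\<bar> = 1"
  by (auto simp: dir_def)

lemma fin_E: "finite (edges G)"
  using fin by (simp add: finite_graph_def)

lemma fin_star [simp]: "finite (star v)"
  using fin_E by (simp add: star_def)

lemma no_loop: "e \<in> edges G \<Longrightarrow> ends G e \<noteq> {v}"
  using ends_AB[of e] AB(2) by (auto simp: doubleton_eq_iff)

lemma star_triple: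
  assumes "v \<in> vertices G"
  obtains x y z where "star v = {x, y, z}" "x \<noteq> y" "x \<noteq> z" "y \<noteq> z"
proof -
  have loops: "{e \<in> edges G. ends G e = {v}} = {}"
    using no_loop by blast
  have "degree G v = 3" using cub assms by (simp add: cubic_def regular_def)
  then have "card (star v) = 3"
    unfolding degree_def loops by (simp add: star_def)
  then show thesis using that by (auto simp: card_3_iff)
qed

text \<open>
  Read from \<open>A\<close> to \<open>B\<close>, all edges leave a vertex of \<open>A\<close> and all edges enter a vertex of \<open>B\<close>, so
  conservation says that the values around each vertex sum to zero.
\<close>

lemma kflow_iff:
  "k_flow k D f \<longleftrightarrow> f \<in> extensional (edges G) \<and>
     (\<forall>e\<in>edges G. 0 < \<bar>f e\<bar> \<and> \<bar>f e\<bar> < int k) \<and>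
     (\<forall>v\<in>vertices G. (\<Sum>e\<in>star v. dir e * f e) = 0)"
proof -
  have D: "verts D = vertices G" "arcs D = edges G"
    and th: "\<And>e. e \<in> edges G \<Longrightarrow> {tail D e, head D e} = ends G e"
    using orient by (auto simp: orientation_def)
  have th': "(tail D e \<in> A \<and> head D e \<in> B) \<or> (tail D e \<in> B \<and> head D e \<in> A)" if "e \<in> edges G" for e
    using th[OF that] ends_AB[OF that] by (auto simp: doubleton_eq_iff)
  have "(\<Sum>e\<in>out_arcs D v. f e) = (\<Sum>e\<in>in_arcs D v. f e) \<longleftrightarrow> (\<Sum>e\<in>star v. dir e * f e) = 0"
    if v: "v \<in> vertices G" for v
  proof -
    define c :: int where "c = (if v \<in> A then 1 else -1)"
    have st: "star v = out_arcs D v \<union> in_arcs D v"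
      by (auto simp: star_def out_arcs_def in_arcs_def D th[symmetric])
    have dj: "out_arcs D v \<inter> in_arcs D v = {}"
      using th' AB(2) D by (fastforce simp: out_arcs_def in_arcs_def)
    have "finite (out_arcs D v)" "finite (in_arcs D v)"
      using fin_star[of v] st by auto
    then have "(\<Sum>e\<in>star v. dir e * f e) = (\<Sum>e\<in>out_arcs D v. dir e * f e) + (\<Sum>e\<in>in_arcs D v. dir e * f e)"
      using dj by (simp add: st sum.union_disjoint)
    also have "(\<Sum>e\<in>out_arcs D v. dir e * f e) = (\<Sum>e\<in>out_arcs D v. c * f e)"
      by (rule sum.cong) (auto simp: dir_def c_def)
    also have "(\<Sum>e\<in>in_arcs D v. dir e * f e) = (\<Sum>e\<in>in_arcs D v. - c * f e)"
      using th' AB D by (intro sum.cong) (auto simp: dir_def c_def in_arcs_def)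
    finally show ?thesis
      by (simp add: sum_distrib_left[symmetric] sum_negf c_def)
  qed
  then show ?thesis unfolding k_flow_def D by auto
qed

definition flow_of :: "('e \<Rightarrow> int) \<Rightarrow> 'e \<Rightarrow> int" where
  "flow_of \<phi> = (\<lambda>e\<in>edges G. dir e * \<phi> e)"

lemma kflow_flow_of:
  assumes "\<And>e. e \<in> edges G \<Longrightarrow> 0 < \<bar>\<phi> e\<bar> \<and> \<bar>\<phi> e\<bar> < int k"
    and "\<And>v. v \<in> vertices G \<Longrightarrow> (\<Sum>e\<in>star v. \<phi> e) = 0"
  shows "k_flow k D (flow_of \<phi>)"
proof -
  have "(\<Sum>e\<in>star v. dir e * flow_of \<phi> e) = (\<Sum>e\<in>star v. \<phi> e)" for v
    by (rule sum.cong) (auto simp: flow_of_def star_def)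
  then show ?thesis
    unfolding kflow_iff using assms by (auto simp: flow_of_def abs_mult)
qed

section \<open>Exchanging two flows along cycles\<close>

text \<open>
  The cycle is the component of \<open>e0\<close> in the graph with edge set \<open>F\<close>. The last clause records that it
  is a whole component: at each of its vertices it has all the edges of \<open>F\<close>.
\<close>

lemma component_is_cycle:
  assumes "F \<subseteq> edges G" and two: "\<And>v. v \<in> vertices G \<Longrightarrow> card (star v \<inter> F) \<in> {0, 2}"
    and "u \<in> ends G e0" "e0 \<in> F"
  shows "\<exists>C. is_cycle C \<and> is_subgraph C G \<and> e0 \<in> edges C \<and> edges C \<subseteq> F \<and>
      (\<forall>e\<in>edges C. \<forall>e'\<in>F. ends G e \<inter> ends G e' \<noteq> {} \<longrightarrow> e' \<in> edges C)"
proof -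
  define R where "R = (\<lambda>x y. \<exists>e\<in>F. ends G e = {x, y})"
  define W where "W = {v. R\<^sup>*\<^sup>* u v}"
  define C where "C = \<lparr>vertices = W, edges = {e \<in> F. ends G e \<subseteq> W}, ends = ends G\<rparr>"
  have symR: "symp R" by (auto simp: R_def symp_def insert_commute)
  have EV: "ends G e \<subseteq> vertices G \<and> card (ends G e) \<in> {1, 2}" if "e \<in> edges G" for e
    using that fin by (auto simp: finite_graph_def)
  have uV: "u \<in> vertices G" using assms EV by blast
  have W_closed: "ends G e \<subseteq> W" if e: "e \<in> F" and v: "v \<in> ends G e" "v \<in> W" for e v
  proof
    fix w assume w: "w \<in> ends G e"
    obtain a b where ab: "ends G e = {a, b}" using ends_AB e assms(1) by blast
    show "w \<in> W"
    proof (cases "w = v")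
      case False
      then have "ends G e = {v, w}" using ab v w by auto
      then have "R v w" using e by (auto simp: R_def)
      then show ?thesis using v(2) by (auto simp: W_def intro: rtranclp.rtrancl_into_rtrancl)
    qed (use v in simp)
  qed
  have WV: "W \<subseteq> vertices G"
  proof
    fix v assume "v \<in> W"
    then have "R\<^sup>*\<^sup>* u v" by (simp add: W_def)
    then show "v \<in> vertices G"
      by induction (use uV EV assms(1) in \<open>auto simp: R_def\<close>)
  qed
  have uW: "u \<in> W" by (simp add: W_def)
  have RC: "(\<lambda>x y. \<exists>e\<in>edges C. ends C e = {x, y})\<^sup>*\<^sup>* u v" if "R\<^sup>*\<^sup>* u v" for v
    using that
  proof induction
    case (step y z)
    then obtain e where e: "e \<in> F" "ends G e = {y, z}" by (auto simp: R_def)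
    have "y \<in> W" using step by (simp add: W_def)
    then have "ends G e \<subseteq> W" using W_closed[of e y] e by simp
    then have "\<exists>e\<in>edges C. ends C e = {y, z}" using e by (auto simp: C_def)
    then show ?case using step.IH by (rule rtranclp.rtrancl_into_rtrancl[rotated])
  qed simp
  have symC: "symp ((\<lambda>x y. \<exists>e\<in>edges C. ends C e = {x, y})\<^sup>*\<^sup>*)"
    by (intro symp_rtranclp) (auto simp: symp_def insert_commute)
  have conn: "connected_graph C"
    unfolding connected_graph_def
  proof (intro conjI ballI)
    show "vertices C \<noteq> {}" using uW by (auto simp: C_def)
    fix x y assume "x \<in> vertices C" "y \<in> vertices C"
    then have "R\<^sup>*\<^sup>* u x" "R\<^sup>*\<^sup>* u y" by (simp_all add: C_def W_def)
    from this[THEN RC] show "(\<lambda>x y. \<exists>e\<in>edges C. ends C e = {x, y})\<^sup>*\<^sup>* x y"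
      using symC by (metis (lifting) sympD rtranclp_trans)
  qed
  have reg: "regular 2 C"
    unfolding regular_def
  proof
    fix v assume "v \<in> vertices C"
    then have v: "v \<in> W" by (simp add: C_def)
    have loops: "{e \<in> edges C. ends C e = {v}} = {}"
      using no_loop assms(1) by (auto simp: C_def)
    have inc: "{e \<in> edges C. v \<in> ends C e} = star v \<inter> F"
      using W_closed[OF _ _ v] assms(1) by (auto simp: C_def star_def)
    have "star v \<inter> F \<noteq> {}"
    proof (cases "v = u")
      case True then show ?thesis using assms by (auto simp: star_def)
    next
      case False
      have "R\<^sup>*\<^sup>* u v" using v by (simp add: W_def)
      then obtain w where "R w v" using False by (meson rtranclp.cases)
      then show ?thesis using assms(1) by (auto simp: R_def star_def)
    qed
    then have "card (star v \<inter> F) = 2" using two[of v] v WV by auto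
    then show "degree C v = 2" unfolding degree_def loops inc by simp
  qed
  have "finite_graph C"
    using fin assms(1) EV WV finite_subset[OF WV] finite_subset[OF assms(1) fin_E]
    by (auto simp: finite_graph_def C_def)
  then have "is_cycle C" using conn reg by (simp add: is_cycle_def)
  moreover have "is_subgraph C G" using WV assms(1) by (auto simp: is_subgraph_def C_def)
  moreover have "e0 \<in> edges C" using assms(4) W_closed[OF assms(4,3) uW] by (simp add: C_def)
  moreover have "edges C \<subseteq> F" by (auto simp: C_def)
  moreover have "e' \<in> edges C" if "e \<in> edges C" "e' \<in> F" "ends G e \<inter> ends G e' \<noteq> {}" for e e'
    using that W_closed[of e'] by (auto simp: C_def)
  ultimately show ?thesis by blast
qed

lemma zero_sum_triple:
  assumes "\<And>v. v \<in> vertices G \<Longrightarrow> (\<Sum>e\<in>star v. \<phi> e :: int) = 0" and "v \<in> vertices G"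
  obtains x y z where "star v = {x, y, z}" "x \<noteq> y" "x \<noteq> z" "y \<noteq> z" "\<phi> x + \<phi> y + \<phi> z = 0"
proof -
  obtain x y z where "star v = {x, y, z}" "x \<noteq> y" "x \<noteq> z" "y \<noteq> z" using star_triple[OF assms(2)] .
  moreover then have "\<phi> x + \<phi> y + \<phi> z = 0" using assms(1)[OF assms(2)] by (simp add: add.assoc)
  ultimately show thesis using that by blast
qed

text \<open>
  Replacing \<open>f\<close> by \<open>g\<close> on one component of the set where they differ yields a flow adjacent to \<open>f\<close>
  that agrees with \<open>g\<close> on more edges. Cubicity makes these components cycles: an odd number of
  terms \<open>c\<close> or \<open>-c\<close> never sums to zero, so \<open>f\<close> and \<open>g\<close> differ on 0 or 2 of the three edges at a vertex.
\<close>

lemma equivalent_if_diff_const: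
  assumes "k_flow k D f" "k_flow k D g" and "c \<noteq> 0"
    and "\<And>e. e \<in> edges G \<Longrightarrow> g e - f e \<in> {0, c, - c}"
  shows "(k_flow_adjacent k G D)\<^sup>*\<^sup>* f g"
  using assms(1,2,4)
proof (induction "card {e \<in> edges G. f e \<noteq> g e}" arbitrary: f rule: less_induct)
  case less
  note f = less.prems(1) and g = less.prems(2) and diff = less.prems(3)
  note f' = f[unfolded kflow_iff] and g' = g[unfolded kflow_iff]
  define F where "F = {e \<in> edges G. f e \<noteq> g e}"
  show ?case
  proof (cases "F = {}")
    case True
    then have "f = g" using f' g' by (intro extensionalityI[of _ "edges G"]) (auto simp: F_def)
    then show ?thesis by simp
  next
    case False
    have two: "card (star v \<inter> F) \<in> {0, 2}" if v: "v \<in> vertices G" for v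
    proof -
      \<comment> \<open>The factor \<open>dir e\<close> keeps the values in \<open>{0, c, -c}\<close> and makes them sum to zero.\<close>
      define d where "d e = dir e * (g e - f e)" for e
      have "(\<Sum>e\<in>star v. d e) = 0" if "v \<in> vertices G" for v
        using f' g' that by (simp add: d_def right_diff_distrib sum_subtractf)
      then obtain x y z where xyz: "star v = {x, y, z}" "x \<noteq> y" "x \<noteq> z" "y \<noteq> z"
        and s: "d x + d y + d z = 0"
        by (rule zero_sum_triple[OF _ v])
      have d: "d e = 0 \<or> d e = c \<or> d e = - c" "e \<in> F \<longleftrightarrow> d e \<noteq> 0" if "e \<in> star v" for e
        using diff[of e] that by (auto simp: star_def d_def dir_def F_def)
      have "star v \<inter> F = {e \<in> {x, y, z}. d e \<noteq> 0}"
        using d(2) xyz(1) by auto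
      also have "\<dots> = (if d x = 0 then {} else {x}) \<union> (if d y = 0 then {} else {y}) \<union> (if d z = 0 then {} else {z})"
        by auto
      finally show ?thesis
        using d(1)[of x] d(1)[of y] d(1)[of z] s xyz \<open>c \<noteq> 0\<close> by auto
    qed
    have FE: "F \<subseteq> edges G" by (auto simp: F_def)
    obtain e0 where e0: "e0 \<in> F" using False by blast
    then obtain u where "u \<in> ends G e0" using ends_AB[of e0] FE by blast
    from component_is_cycle[OF FE two this e0] obtain C where
      C: "is_cycle C" "is_subgraph C G" "e0 \<in> edges C" "edges C \<subseteq> F"
        and closed: "\<And>e e'. e \<in> edges C \<Longrightarrow> e' \<in> F \<Longrightarrow> ends G e \<inter> ends G e' \<noteq> {} \<Longrightarrow> e' \<in> edges C"
      by blast
    define h where "h = (\<lambda>e. if e \<in> edges C then g e else f e)"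
    have h: "k_flow k D h"
      unfolding kflow_iff
    proof (intro conjI ballI)
      show "h \<in> extensional (edges G)" using f' g' by (auto simp: h_def extensional_def)
    next
      fix v assume v: "v \<in> vertices G"
      show "(\<Sum>e\<in>star v. dir e * h e) = 0"
      proof (cases "\<exists>e\<in>edges C. v \<in> ends G e")
        case True
        then have "(\<Sum>e\<in>star v. dir e * h e) = (\<Sum>e\<in>star v. dir e * g e)"
          using closed by (intro sum.cong) (auto simp: h_def F_def star_def)
        then show ?thesis using g' v by simp
      next
        case False
        then have "(\<Sum>e\<in>star v. dir e * h e) = (\<Sum>e\<in>star v. dir e * f e)"
          by (intro sum.cong) (auto simp: h_def star_def)
        then show ?thesis using f' v by simp
      qed
    qed (use f' g' in \<open>auto simp: h_def\<close>)
    have "k_flow_adjacent k G D f h"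
      using f h C(1,2) by (auto simp: k_flow_adjacent_def h_def)
    moreover have "(k_flow_adjacent k G D)\<^sup>*\<^sup>* h g"
    proof (rule less.hyps[OF _ h g])
      have "{e \<in> edges G. h e \<noteq> g e} \<subset> {e \<in> edges G. f e \<noteq> g e}"
        using C(3) e0 by (auto simp: h_def F_def)
      then show "card {e \<in> edges G. h e \<noteq> g e} < card {e \<in> edges G. f e \<noteq> g e}"
        using fin_E by (intro psubset_card_mono) auto
      show "g e - h e \<in> {0, c, - c}" if "e \<in> edges G" for e
        using diff[OF that] by (auto simp: h_def)
    qed
    ultimately show ?thesis by (rule converse_rtranclp_into_rtranclp)
  qed
qed

section \<open>Balanced signings of 2-regular edge sets\<close>

text \<open>
  Bipartiteness is essential, as odd cycles have no balanced signing. Every edge has one end in \<open>A\<close>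
  and one in \<open>B\<close>; let \<open>p\<close> and \<open>q\<close> give the other edge of \<open>F\<close> at these ends. A signing that
  alternates under both involutions is balanced at every vertex.
\<close>

lemma balanced_signing:
  assumes "F \<subseteq> edges G" and two: "\<And>v. v \<in> vertices G \<Longrightarrow> card (star v \<inter> F) \<in> {0, 2}"
  shows "\<exists>s :: 'e \<Rightarrow> int. (\<forall>e\<in>F. s e \<in> {1, -1}) \<and> (\<forall>v\<in>vertices G. (\<Sum>e\<in>star v \<inter> F. s e) = 0)"
proof -
  have finF: "finite F" using assms(1) fin_E finite_subset by blast
  have "\<exists>p. \<forall>e\<in>F. p e \<in> F \<and> p e \<noteq> e \<and> p (p e) = e \<and> (\<forall>v\<in>X \<inter> ends G e. star v \<inter> F = {e, p e})"
    if X: "X \<subseteq> vertices G" and one: "\<And>e. e \<in> F \<Longrightarrow> \<exists>v. X \<inter> ends G e = {v}" for X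
  proof -
    obtain t where t: "\<And>e. e \<in> F \<Longrightarrow> X \<inter> ends G e = {t e}" using one by metis
    have fib: "{e' \<in> F. t e' = t e} = star (t e) \<inter> F" if "e \<in> F" for e
    proof -
      have "t e' = t e \<longleftrightarrow> t e \<in> ends G e'" if "e' \<in> F" for e'
      proof -
        have "t e \<in> X" using t[OF \<open>e \<in> F\<close>] by blast
        then have "t e \<in> ends G e' \<longleftrightarrow> t e \<in> {t e'}" unfolding t[OF that, symmetric] by simp
        then show ?thesis by auto
      qed
      then show ?thesis using assms(1) by (auto simp: star_def)
    qed
    have "card {e' \<in> F. t e' = t e} = 2" if e: "e \<in> F" for e
    proof -
      have "e \<in> star (t e) \<inter> F" "t e \<in> vertices G" using t e assms(1) X by (auto simp: star_def)
      then show ?thesis using two[of "t e"] finF by (auto simp: fib[OF e])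
    qed
    from fiber_partner[where t = t, OF finF this] obtain p where
      p: "\<forall>e\<in>F. p e \<in> F \<and> p e \<noteq> e \<and> p (p e) = e \<and> {e' \<in> F. t e' = t e} = {e, p e}"
      by blast
    have "\<forall>v\<in>X \<inter> ends G e. star v \<inter> F = {e, p e}" if "e \<in> F" for e
      using p that by (simp add: t fib)
    then show ?thesis using p by blast
  qed note pairing = this
  have one: "\<exists>v. A \<inter> ends G e = {v}" "\<exists>v. B \<inter> ends G e = {v}" if "e \<in> F" for e
  proof -
    obtain a b where "a \<in> A" "b \<in> B" "ends G e = {a, b}"
      using ends_AB[of e] \<open>e \<in> F\<close> assms(1) by blast
    then have "A \<inter> ends G e = {a}" "B \<inter> ends G e = {b}" using AB(2) by auto
    then show "\<exists>v. A \<inter> ends G e = {v}" "\<exists>v. B \<inter> ends G e = {v}" by blast+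
  qed
  obtain p where p: "\<forall>e\<in>F. p e \<in> F \<and> p e \<noteq> e \<and> p (p e) = e \<and> (\<forall>v\<in>A \<inter> ends G e. star v \<inter> F = {e, p e})"
    using pairing[of A] one(1) AB by blast
  obtain q where q: "\<forall>e\<in>F. q e \<in> F \<and> q e \<noteq> e \<and> q (q e) = e \<and> (\<forall>v\<in>B \<inter> ends G e. star v \<inter> F = {e, q e})"
    using pairing[of B] one(2) AB by blast
  obtain s where s: "\<forall>e\<in>F. s (p e) = (\<not> s e) \<and> s (q e) = (\<not> s e)"
  proof -
    have "p e \<in> F \<and> p e \<noteq> e \<and> p (p e) = e" "q e \<in> F \<and> q e \<noteq> e \<and> q (q e) = e" if "e \<in> F" for e
      using p q that by simp_all
    from involutions_signing[OF finF this] show thesis using that by blast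
  qed
  have "(\<Sum>e\<in>star v \<inter> F. if s e then 1 else -1 :: int) = 0" if v: "v \<in> vertices G" for v
  proof (cases "star v \<inter> F = {}")
    case False
    then obtain e where e: "e \<in> F" "v \<in> ends G e" by (auto simp: star_def)
    have "v \<in> A \<or> v \<in> B" using v AB by blast
    moreover have "star v \<inter> F = {e, p e}" if "v \<in> A" using p[rule_format, OF e(1)] e(2) that by blast
    moreover have "star v \<inter> F = {e, q e}" if "v \<in> B" using q[rule_format, OF e(1)] e(2) that by blast
    moreover have "p e \<noteq> e" "s (p e) = (\<not> s e)" "q e \<noteq> e" "s (q e) = (\<not> s e)"
      using p[rule_format, OF e(1)] q[rule_format, OF e(1)] s[rule_format, OF e(1)] by simp_all
    ultimately show ?thesis by (elim disjE) (simp_all add: eq_commute[of e])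
  qed simp
  then show ?thesis by (intro exI[of _ "\<lambda>e. if s e then 1 else -1"]) auto
qed

section \<open>Joining every 4-flow to a canonical one\<close>

definition canonical :: "('e \<Rightarrow> int) \<Rightarrow> 'e \<Rightarrow> int" where
  "canonical f e = (if even (f e) then -2 else 1)"

text \<open>Up to order and a common sign, the values at a vertex are \<open>1, 1, -2\<close> or \<open>1, -3, 2\<close>.\<close>

lemma vertex_type:
  fixes x y z :: int
  assumes "x + y + z = 0" "0 < \<bar>x\<bar>" "\<bar>x\<bar> < 4" "0 < \<bar>y\<bar>" "\<bar>y\<bar> < 4" "0 < \<bar>z\<bar>" "\<bar>z\<bar> < 4"
  shows "even x \<and> odd y \<and> odd z \<and> y mod 4 = z mod 4 \<or>
     even y \<and> odd x \<and> odd z \<and> x mod 4 = z mod 4 \<or>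
     even z \<and> odd x \<and> odd y \<and> x mod 4 = y mod 4"
proof -
  have r: "t \<in> {-3, -2, -1, 1, 2, 3}" if "0 < \<bar>t\<bar>" "\<bar>t\<bar> < 4" for t :: int
    using that by auto
  have z: "z = - x - y" using assms(1) by simp
  show ?thesis
    using r[OF assms(2,3)] r[OF assms(4,5)] assms(6,7) unfolding z by (elim insertE emptyE; simp)
qed

lemma flow_triple:
  assumes "k_flow 4 D f" "v \<in> vertices G"
  obtains x y z where "star v = {x, y, z}" "x \<noteq> y" "x \<noteq> z" "y \<noteq> z"
    "even (f x)" "odd (f y)" "odd (f z)" "(dir y * f y) mod 4 = (dir z * f z) mod 4"
proof -
  note f = assms(1)[unfolded kflow_iff]
  have ev: "even (dir e * f e) = even (f e)" for e by (simp add: dir_def)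
  have "(\<Sum>e\<in>star v. dir e * f e) = 0" if "v \<in> vertices G" for v
    using f that by blast
  then obtain x y z where xyz: "star v = {x, y, z}" "x \<noteq> y" "x \<noteq> z" "y \<noteq> z"
    "dir x * f x + dir y * f y + dir z * f z = 0"
    by (rule zero_sum_triple[OF _ assms(2)])
  have E: "x \<in> edges G" "y \<in> edges G" "z \<in> edges G" using xyz(1) by (auto simp: star_def)
  have "0 < \<bar>dir e * f e\<bar> \<and> \<bar>dir e * f e\<bar> < 4" if "e \<in> edges G" for e
    using f that by (auto simp: abs_mult)
  from vertex_type[OF xyz(5)] this[OF E(1)] this[OF E(2)] this[OF E(3)]
  consider "even (f x) \<and> odd (f y) \<and> odd (f z) \<and> (dir y * f y) mod 4 = (dir z * f z) mod 4"
    | "even (f y) \<and> odd (f x) \<and> odd (f z) \<and> (dir x * f x) mod 4 = (dir z * f z) mod 4"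
    | "even (f z) \<and> odd (f x) \<and> odd (f y) \<and> (dir x * f x) mod 4 = (dir y * f y) mod 4"
    unfolding ev by blast
  then show thesis
  proof cases
    case 1 then show ?thesis using that[of x y z] xyz by blast
  next
    case 2 then show ?thesis using that[of y x z] xyz by (simp add: insert_commute)
  next
    case 3 then show ?thesis using that[of z x y] xyz by (simp add: insert_commute)
  qed
qed

lemma canonical_zero_sum:
  assumes "k_flow 4 D f" "v \<in> vertices G"
  shows "(\<Sum>e\<in>star v. canonical f e) = 0"
proof -
  obtain x y z where "star v = {x, y, z}" "x \<noteq> y" "x \<noteq> z" "y \<noteq> z"
    "even (f x)" "odd (f y)" "odd (f z)" by (rule flow_triple[OF assms])
  then show ?thesis by (simp add: canonical_def)
qed

lemma canonical_flow: "k_flow 4 D f \<Longrightarrow> k_flow 4 D (flow_of (canonical f))"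
  using canonical_zero_sum by (intro kflow_flow_of) (auto simp: canonical_def)

text \<open>
  On the symmetric difference of the two perfect matchings of even edges, one flow has value \<open>-2\<close>
  where the other has value \<open>1\<close>; elsewhere they agree.
\<close>

lemma canonical_equivalent:
  assumes "k_flow 4 D f" "k_flow 4 D g"
  shows "(k_flow_adjacent 4 G D)\<^sup>*\<^sup>* (flow_of (canonical f)) (flow_of (canonical g))"
  by (rule equivalent_if_diff_const[where c = 3, OF assms[THEN canonical_flow]])
     (auto simp: flow_of_def canonical_def dir_def)

text \<open>
  If no value of \<open>f\<close>, read from \<open>A\<close> to \<open>B\<close>, were congruent to 3 modulo 4, then \<open>f\<close> and the
  canonical flow would differ by multiples of 4 and the exchange principle would apply directly. The components of \<open>F\<close> have to be
  negated modulo 4 first; an exchange with difference 2 does that, but not every lift of the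
  residues of \<open>f\<close> to integers allows it. The lift \<open>\<gamma>\<close> does, because it is built from the canonical
  flow by such an exchange.
\<close>

lemma flow_equivalent_canonical:
  assumes f: "k_flow 4 D f"
  shows "(k_flow_adjacent 4 G D)\<^sup>*\<^sup>* f (flow_of (canonical f))"
proof -
  note f' = f[unfolded kflow_iff]
  define F where "F = {e \<in> edges G. (dir e * f e) mod 4 = 3}"
  have FE: "F \<subseteq> edges G" by (auto simp: F_def)
  have mod3: "odd a" if "a mod 4 = 3" for a :: int using that by presburger
  have two: "card (star v \<inter> F) \<in> {0, 2}" if v: "v \<in> vertices G" for v
  proof -
    obtain x y z where xyz: "star v = {x, y, z}" "x \<noteq> y" "x \<noteq> z" "y \<noteq> z"
    "even (f x)" "odd (f y)" "odd (f z)" "(dir y * f y) mod 4 = (dir z * f z) mod 4"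
      by (rule flow_triple[OF f v])
    have E: "x \<in> edges G" "y \<in> edges G" "z \<in> edges G" using xyz(1) by (auto simp: star_def)
    have "(dir x * f x) mod 4 \<noteq> 3" using mod3[of "dir x * f x"] xyz(5) by auto
    then have "star v \<inter> F = (if (dir z * f z) mod 4 = 3 then {y, z} else {})"
      using E xyz(8) by (auto simp: F_def xyz(1))
    then show ?thesis using xyz(4) by simp
  qed
  obtain s :: "'e \<Rightarrow> int" where s: "\<forall>e\<in>F. s e \<in> {1, -1}"
    and s0: "\<forall>v\<in>vertices G. (\<Sum>e\<in>star v \<inter> F. s e) = 0"
    using balanced_signing[OF FE two] by blast
  \<comment> \<open>On \<open>F\<close> the value is \<open>1 - 2 * s e\<close>, that is \<open>-1\<close> or \<open>3\<close>, both congruent to 3 modulo 4.\<close>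
  define \<gamma> where "\<gamma> e = canonical f e - 2 * (if e \<in> F then s e else 0)" for e
  have oddF: "odd (f e)" if "e \<in> F" for e
  proof -
    have "(dir e * f e) mod 4 = 3" using that by (simp add: F_def)
    then have "odd (dir e * f e)" by (rule mod3)
    then show ?thesis by simp
  qed
  have g: "k_flow 4 D (flow_of \<gamma>)"
  proof (rule kflow_flow_of)
    fix e assume "e \<in> edges G"
    show "0 < \<bar>\<gamma> e\<bar> \<and> \<bar>\<gamma> e\<bar> < int 4"
      using s oddF[of e] by (auto simp: \<gamma>_def canonical_def)
  next
    fix v assume v: "v \<in> vertices G"
    have "(\<Sum>e\<in>star v. if e \<in> F then s e else 0) = (\<Sum>e\<in>star v \<inter> F. s e)"
      by (simp add: sum.inter_restrict)
    then show "(\<Sum>e\<in>star v. \<gamma> e) = 0"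
      using canonical_zero_sum[OF f v] s0 v
      by (simp add: \<gamma>_def sum_subtractf sum_distrib_left[symmetric])
  qed
  have "(k_flow_adjacent 4 G D)\<^sup>*\<^sup>* f (flow_of \<gamma>)"
  proof (rule equivalent_if_diff_const[where c = 4, OF f g])
    fix e assume e: "e \<in> edges G"
    define a where "a = dir e * f e"
    have fa: "f e = dir e * a" by (simp add: a_def)
    have "a \<in> {-3, -2, -1, 1, 2, 3}" using f' e by (auto simp: a_def dir_def)
    moreover have "even (f e) = even a" by (simp add: a_def dir_def)
    moreover have "e \<in> F \<longleftrightarrow> a mod 4 = 3" using e by (simp add: F_def a_def)
    ultimately have "\<gamma> e - a \<in> {0, 4, -4}"
      using s by (auto simp: \<gamma>_def canonical_def)
    then show "flow_of \<gamma> e - f e \<in> {0, 4, - 4}"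
      using e by (auto simp: flow_of_def fa dir_def)
  qed simp
  also have "(k_flow_adjacent 4 G D)\<^sup>*\<^sup>* (flow_of \<gamma>) (flow_of (canonical f))"
    by (rule equivalent_if_diff_const[where c = 2, OF g canonical_flow[OF f]])
       (use s in \<open>auto simp: flow_of_def \<gamma>_def dir_def\<close>)
  finally show ?thesis .
qed

lemma adjacent_sym: "symp (k_flow_adjacent k G D)"
  unfolding symp_def k_flow_adjacent_def by (metis (no_types))

lemma four_flows_equivalent:
  assumes f: "k_flow 4 D f" and g: "k_flow 4 D g"
  shows "k_flow_equivalent 4 G D f g"
proof -
  have "(k_flow_adjacent 4 G D)\<^sup>*\<^sup>* (flow_of (canonical g)) g"
    using flow_equivalent_canonical[OF g] symp_rtranclp[OF adjacent_sym] by (metis sympD)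
  then show ?thesis
    using flow_equivalent_canonical[OF f] canonical_equivalent[OF f g] f g
    by (auto simp: k_flow_equivalent_def intro: rtranclp_trans)
qed

end

theorem theorem3p2:
  fixes G :: "('v, 'e) mgraph"
  assumes "finite_graph G" and "cubic G" and "bipartite G"
  shows "k_flow_connected 4 G"
proof -
  obtain A B where "A \<union> B = vertices G" "A \<inter> B = {}"
    "\<forall>e\<in>edges G. \<exists>a\<in>A. \<exists>b\<in>B. ends G e = {a, b}"
    using assms(3) by (auto simp: bipartite_def)
  then have "oriented_cubic_bipartite G A B D" if "orientation D G" for D
    using assms(1,2) that by (simp add: oriented_cubic_bipartite_def)
  then show ?thesis
    unfolding k_flow_connected_def
    using oriented_cubic_bipartite.four_flows_equivalent by blast
qed

end
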